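(* Let $\mathbf u^0$ be such that $\|\mathbf u^0\|_\infty\le\frac\pi2$. Then the discrete scheme $$\frac{\mathbf u^{n+1}-\mathbf u^n}{\Delta t}=-C\mathbf u^{n+1}-G(\mathbf u^n)D^{-2}\mathbf u^{n+1},\qquad 0\le n\le M-1,$$ is well-defined (i.e. each step determines a unique $\mathbf u^{n+1}\in\mathbb R^N$), and $\|\mathbf u^n\|_\infty\le\|\mathbf u^0\|_\infty$ holds for all $n$ (i.e. $0\le n\le M$).
   Context: Let $I=[0,1]$, $T>0$, and let $u_0:I\to\mathbb R$ with $u_0(0)=u_0(1)=0$. Let $N\in\mathbb N$, $h=\frac{1}{N+1}$, $x_i=ih$ for $0\le i\le N+1$, $M\in\mathbb N$, $\Delta t=\frac TM$. Define the $N\times N$ matrices $$A=\frac1{h^2}\mathrm{tridiag}(-1,2,-1),\quad B=\frac1{2h}\mathrm{tridiag}(-1,0,1),\quad D=\mathrm{diag}(x_1,\ldots,x_N),\quad C=A-D^{-1}B.$$ For $\mathbf u=(u_1,\ldots,u_N)^T\in\mathbb R^N$ let $G(\mathbf u)=\mathrm{diag}\big(\frac{\sin(2u_1)}{2u_1},\ldots,\frac{\sin(2u_N)}{2u_N}\big)$, with the convention that $\frac{\sin(2y)}{2y}=1$ at $y=0$. The starting vector of the scheme is $\mathbf u^0=(u_0(x_1),\ldots,u_0(x_N))^T$. $\|\mathbf v\|_\infty=\max_i|v_i|$. *)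

theory Defs
  imports Complex_Main "Jordan_Normal_Form.Gauss_Jordan_Elimination"
begin

text \<open>Vectors and matrices are indexed from \<open>0\<close>: entry \<open>j\<close> with \<open>j < N\<close> belongs to the
  interior grid point \<open>gridpt N (Suc j)\<close>. The problem data are \<open>N\<close>, the final time \<open>T\<close> and
  the number \<open>M\<close> of time steps.\<close>

definition meshwidth :: "nat \<Rightarrow> real" where
  "meshwidth N = 1 / (real N + 1)"

definition gridpt :: "nat \<Rightarrow> nat \<Rightarrow> real" where
  "gridpt N i = real i * meshwidth N"

definition timestep :: "real \<Rightarrow> nat \<Rightarrow> real" where
  "timestep T M = T / real M"

text \<open>\<open>tridiag n a b c\<close> has \<open>a\<close> on the subdiagonal, \<open>b\<close> on the diagonal and \<open>c\<close> on the
  superdiagonal.\<close>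

definition tridiag :: "nat \<Rightarrow> real \<Rightarrow> real \<Rightarrow> real \<Rightarrow> real mat" where
  "tridiag n a b c = mat n n (\<lambda>(i, j).
     if i = Suc j then a else if i = j then b else if j = Suc i then c else 0)"

definition A_mat :: "nat \<Rightarrow> real mat" where
  "A_mat N = (1 / (meshwidth N)\<^sup>2) \<cdot>\<^sub>m tridiag N (-1) 2 (-1)"

definition B_mat :: "nat \<Rightarrow> real mat" where
  "B_mat N = (1 / (2 * meshwidth N)) \<cdot>\<^sub>m tridiag N (-1) 0 1"

definition D_mat :: "nat \<Rightarrow> real mat" where
  "D_mat N = mat_diag N (\<lambda>j. gridpt N (Suc j))"

definition Dinv_mat :: "nat \<Rightarrow> real mat" where
  "Dinv_mat N = the (mat_inverse (D_mat N))"

definition C_mat :: "nat \<Rightarrow> real mat" where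
  "C_mat N = A_mat N - Dinv_mat N * B_mat N"

definition G_mat :: "real vec \<Rightarrow> real mat" where
  "G_mat u = mat_diag (dim_vec u)
     (\<lambda>j. if u $ j = 0 then 1 else sin (2 * u $ j) / (2 * u $ j))"

text \<open>Only meaningful for vectors of positive dimension.\<close>

definition linf_norm :: "real vec \<Rightarrow> real" where
  "linf_norm v = Max {\<bar>v $ i\<bar> | i. i < dim_vec v}"

definition start_vec :: "nat \<Rightarrow> (real \<Rightarrow> real) \<Rightarrow> real vec" where
  "start_vec N u0 = vec N (\<lambda>j. u0 (gridpt N (Suc j)))"

definition scheme_step :: "nat \<Rightarrow> real \<Rightarrow> nat \<Rightarrow> real vec \<Rightarrow> real vec \<Rightarrow> bool" where
  "scheme_step N T M u w \<longleftrightarrow>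
     (1 / timestep T M) \<cdot>\<^sub>v (w - u)
       = (- C_mat N) *\<^sub>v w - (G_mat u * Dinv_mat N ^\<^sub>m 2) *\<^sub>v w"

text \<open>\<open>U 0, \<dots>, U n\<close> are the starting vector and the results of the first \<open>n\<close> steps of the
  scheme; the values \<open>U k\<close> for \<open>k > n\<close> are irrelevant.\<close>

definition scheme_upto ::
  "nat \<Rightarrow> real \<Rightarrow> nat \<Rightarrow> (real \<Rightarrow> real) \<Rightarrow> nat \<Rightarrow> (nat \<Rightarrow> real vec) \<Rightarrow> bool" where
  "scheme_upto N T M u0 n U \<longleftrightarrow>
     U 0 = start_vec N u0 \<and> (\<forall>k\<le>n. U k \<in> carrier_vec N) \<and>
     (\<forall>k<n. scheme_step N T M (U k) (U (Suc k)))"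

text \<open>The inverse in \<open>Dinv_mat\<close> exists, so that \<open>the\<close> is harmless there.\<close>

lemma Dinv_mat_inverse:
  "D_mat N * Dinv_mat N = 1\<^sub>m N" "Dinv_mat N * D_mat N = 1\<^sub>m N" "Dinv_mat N \<in> carrier_mat N N"
proof -
  have D: "D_mat N \<in> carrier_mat N N" by (simp add: D_mat_def)
  define E where "E = mat_diag N (\<lambda>j. inverse (gridpt N (Suc j)))"
  have pos: "gridpt N (Suc j) \<noteq> 0" for j
    by (simp add: gridpt_def meshwidth_def add_nonneg_eq_0_iff)
  have "D_mat N * E = 1\<^sub>m N" "E * D_mat N = 1\<^sub>m N" "E \<in> carrier_mat N N"
    using pos by (simp_all add: D_mat_def E_def)
  then have "D_mat N \<in> Units (ring_mat TYPE(real) N ())"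
    using D unfolding Units_def by (auto simp: ring_mat_simps)
  then obtain F where "mat_inverse (D_mat N) = Some F"
    using mat_inverse(1)[OF D, where b = "()"] by (cases "mat_inverse (D_mat N)") auto
  then show "D_mat N * Dinv_mat N = 1\<^sub>m N" "Dinv_mat N * D_mat N = 1\<^sub>m N"
    "Dinv_mat N \<in> carrier_mat N N"
    using mat_inverse(2)[OF D] by (auto simp: Dinv_mat_def)
qed

end

theory Submission
  imports Defs "Jordan_Normal_Form.Determinant"
begin

text \<open>A step of the scheme is a linear system \<open>S w = u / \<Delta>t\<close>. Row \<open>i\<close> of \<open>h\<^sup>2 C\<close> (counted from 1)
  has diagonal entry \<open>2\<close> and off-diagonal entries \<open>- (1 - 1/(2 i))\<close>, \<open>- (1 + 1/(2 i))\<close>,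
  both nonpositive. Since \<open>sin (2 y) / (2 y) \<ge> 0\<close> for \<open>\<bar>y\<bar> \<le> \<pi>/2\<close>, every row of \<open>S\<close> is strictly
  diagonally dominant with excess at least \<open>1 / \<Delta>t\<close>. Evaluating \<open>S w\<close> at an index where
  \<open>\<bar>w i\<bar>\<close> is maximal gives \<open>\<parallel>w\<parallel> \<le> \<Delta>t \<parallel>S w\<parallel> = \<parallel>u\<parallel>\<close>, and \<open>S\<close> is invertible.\<close>

section \<open>Maximum norm and diagonally dominant matrices\<close>

lemma linf_norm_ge: "i < dim_vec v \<Longrightarrow> \<bar>v $ i\<bar> \<le> linf_norm v"
  unfolding linf_norm_def by (rule Max_ge) auto

lemma linf_norm_attained:
  assumes "0 < dim_vec v"
  obtains i where "i < dim_vec v" "linf_norm v = \<bar>v $ i\<bar>"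
proof -
  have "linf_norm v \<in> {\<bar>v $ i\<bar> | i. i < dim_vec v}"
    unfolding linf_norm_def using assms by (intro Max_in) auto
  then show thesis using that by blast
qed

lemma linf_norm_smult:
  assumes "0 < dim_vec v"
  shows "linf_norm (c \<cdot>\<^sub>v v) = \<bar>c\<bar> * linf_norm v"
proof (rule antisym)
  obtain i where "i < dim_vec (c \<cdot>\<^sub>v v)" "linf_norm (c \<cdot>\<^sub>v v) = \<bar>(c \<cdot>\<^sub>v v) $ i\<bar>"
    using assms linf_norm_attained[of "c \<cdot>\<^sub>v v"] by auto
  then show "linf_norm (c \<cdot>\<^sub>v v) \<le> \<bar>c\<bar> * linf_norm v"
    using linf_norm_ge[of i v] by (simp add: abs_mult mult_left_mono)
next
  obtain i where "i < dim_vec v" "linf_norm v = \<bar>v $ i\<bar>"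
    using assms by (rule linf_norm_attained)
  then show "\<bar>c\<bar> * linf_norm v \<le> linf_norm (c \<cdot>\<^sub>v v)"
    using linf_norm_ge[of i "c \<cdot>\<^sub>v v"] by (simp add: abs_mult)
qed

text \<open>Reverse triangle inequality in a row where \<open>w\<close> attains its norm: the
  off-diagonal terms cancel at most their absolute row sum times that norm, which leaves
  \<open>c\<close> times it.\<close>

lemma diag_dominant_linf_norm_le:
  fixes S :: "real mat"
  assumes S: "S \<in> carrier_mat n n" and w: "w \<in> carrier_vec n" and n: "0 < n"
    and dom: "\<And>i. i < n \<Longrightarrow> c + (\<Sum>j\<in>{..<n} - {i}. \<bar>S $$ (i, j)\<bar>) \<le> S $$ (i, i)"
  shows "c * linf_norm w \<le> linf_norm (S *\<^sub>v w)"
proof -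
  define m where "m = linf_norm w"
  obtain i where i: "i < n" and mi: "m = \<bar>w $ i\<bar>"
    using linf_norm_attained[of w] w n unfolding m_def by auto
  have m: "\<bar>w $ j\<bar> \<le> m" if "j < n" for j
    using that w linf_norm_ge[of j w] by (simp add: m_def)
  define r where "r = (\<Sum>j\<in>{..<n} - {i}. S $$ (i, j) * w $ j)"
  have Sw: "(S *\<^sub>v w) $ i = S $$ (i, i) * w $ i + r"
  proof -
    have "(S *\<^sub>v w) $ i = (\<Sum>j\<in>{..<n}. S $$ (i, j) * w $ j)"
      using S w i by (simp add: scalar_prod_def atLeast0LessThan)
    also have "\<dots> = S $$ (i, i) * w $ i + r"
      unfolding r_def using i by (subst sum.remove[of _ i]) auto
    finally show ?thesis .
  qed
  have "\<bar>r\<bar> \<le> (\<Sum>j\<in>{..<n} - {i}. \<bar>S $$ (i, j)\<bar> * m)"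
    unfolding r_def
    by (rule order_trans[OF sum_abs], rule sum_mono) (auto simp: abs_mult intro!: mult_left_mono m)
  then have r: "\<bar>r\<bar> \<le> (\<Sum>j\<in>{..<n} - {i}. \<bar>S $$ (i, j)\<bar>) * m"
    by (simp add: sum_distrib_right)
  have "(c + (\<Sum>j\<in>{..<n} - {i}. \<bar>S $$ (i, j)\<bar>)) * m \<le> S $$ (i, i) * m"
    using dom[OF i] mi by (intro mult_right_mono) auto
  also have "\<dots> \<le> \<bar>S $$ (i, i) * w $ i\<bar>"
    unfolding mi abs_mult by (intro mult_right_mono) auto
  finally have "c * m \<le> \<bar>S $$ (i, i) * w $ i\<bar> - \<bar>r\<bar>"
    using r by (simp add: algebra_simps)
  also have "\<dots> \<le> \<bar>(S *\<^sub>v w) $ i\<bar>"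
    unfolding Sw by linarith
  also have "\<dots> \<le> linf_norm (S *\<^sub>v w)"
    using S i by (intro linf_norm_ge) auto
  finally show ?thesis by (simp add: m_def)
qed

text \<open>By the preceding bound a kernel vector has norm at most 0, so the determinant is nonzero
  and a two-sided inverse exists.\<close>

lemma diag_dominant_ex1_solution:
  fixes S :: "real mat"
  assumes S: "S \<in> carrier_mat n n" and b: "b \<in> carrier_vec n" and c: "0 < c"
    and dom: "\<And>i. i < n \<Longrightarrow> c + (\<Sum>j\<in>{..<n} - {i}. \<bar>S $$ (i, j)\<bar>) \<le> S $$ (i, i)"
  shows "\<exists>!w. w \<in> carrier_vec n \<and> S *\<^sub>v w = b"
proof -
  have "v = 0\<^sub>v n" if v: "v \<in> carrier_vec n" and 0: "S *\<^sub>v v = 0\<^sub>v n" for v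
  proof (intro eq_vecI)
    \<comment> \<open>The index \<open>i\<close> supplies \<open>0 < n\<close>, which the norm bound
      requires; dimension zero is thus covered too.\<close>
    fix i assume "i < dim_vec (0\<^sub>v n :: real vec)"
    then have i: "i < n" by simp
    have "linf_norm (0\<^sub>v n) = 0"
      using i linf_norm_attained[of "0\<^sub>v n"] by auto
    then have "c * linf_norm v \<le> 0"
      using diag_dominant_linf_norm_le[OF S v _ dom] i 0 by simp
    then have "linf_norm v \<le> 0" using c by (simp add: mult_le_0_iff)
    then show "v $ i = 0\<^sub>v n $ i"
      using linf_norm_ge[of i v] v i by simp
  qed (use v in simp)
  then have "det S \<noteq> 0"
    using det_0_iff_vec_prod_zero_field[OF S] by blast
  then obtain R where R: "R \<in> carrier_mat n n" and RS: "R * S = 1\<^sub>m n" and SR: "S * R = 1\<^sub>m n"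
    using det_non_zero_imp_unit[OF S, where b = "()"] unfolding Units_def by (auto simp: ring_mat_simps)
  show ?thesis
  proof (intro ex1I conjI)
    show "R *\<^sub>v b \<in> carrier_vec n" using R b by simp
    show "S *\<^sub>v (R *\<^sub>v b) = b"
      using assoc_mult_mat_vec[OF S R b] SR b by simp
    fix w assume "w \<in> carrier_vec n \<and> S *\<^sub>v w = b"
    then show "w = R *\<^sub>v b"
      using assoc_mult_mat_vec[OF R S, of w] RS by auto
  qed
qed

section \<open>The linear system of one step\<close>

lemma meshwidth_pos: "0 < meshwidth N"
  by (simp add: meshwidth_def add_nonneg_pos)

text \<open>\<open>Dinv_mat\<close> is defined by Gauss-Jordan elimination; uniqueness of inverses
  turns it into a matrix with explicit entries.\<close>

lemma Dinv_mat_eq: "Dinv_mat N = mat_diag N (\<lambda>j. 1 / gridpt N (Suc j))"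
proof -
  define E where "E = mat_diag N (\<lambda>j. 1 / gridpt N (Suc j))"
  have nz: "gridpt N (Suc j) \<noteq> 0" for j
    using meshwidth_pos[of N] by (simp add: gridpt_def)
  have E: "E \<in> carrier_mat N N" and D: "D_mat N \<in> carrier_mat N N"
    by (simp_all add: E_def D_mat_def)
  have "D_mat N * E = 1\<^sub>m N"
    using nz by (simp add: D_mat_def E_def)
  then have "Dinv_mat N = Dinv_mat N * (D_mat N * E)"
    using right_mult_one_mat[OF Dinv_mat_inverse(3)] by simp
  also have "\<dots> = Dinv_mat N * D_mat N * E"
    using assoc_mult_mat[OF Dinv_mat_inverse(3) D E] by simp
  also have "\<dots> = E"
    using E Dinv_mat_inverse(2) by simp
  finally show ?thesis by (simp add: E_def)
qed

text \<open>The matrix \<open>S\<close> of the overview. The nonlinear factor is evaluated at the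
  old vector \<open>u\<close>, so the system is linear in the new one.\<close>

definition step_mat :: "nat \<Rightarrow> real \<Rightarrow> nat \<Rightarrow> real vec \<Rightarrow> real mat" where
  "step_mat N T M u =
     (1 / timestep T M) \<cdot>\<^sub>m 1\<^sub>m N + C_mat N + G_mat u * Dinv_mat N ^\<^sub>m 2"

lemma C_mat_carrier: "C_mat N \<in> carrier_mat N N"
  using Dinv_mat_inverse(3)[of N]
  by (auto simp: C_mat_def A_mat_def B_mat_def tridiag_def)

lemma reaction_mat_eq:
  assumes "u \<in> carrier_vec N"
  shows "G_mat u * Dinv_mat N ^\<^sub>m 2 = mat_diag N (\<lambda>j.
    (if u $ j = 0 then 1 else sin (2 * u $ j) / (2 * u $ j)) / (gridpt N (Suc j))\<^sup>2)"
  using assms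
  by (auto simp: G_mat_def Dinv_mat_eq numeral_2_eq_2 power2_eq_square intro!: eq_matI)

lemma step_mat_carrier: "u \<in> carrier_vec N \<Longrightarrow> step_mat N T M u \<in> carrier_mat N N"
  using C_mat_carrier[of N] by (simp add: step_mat_def reaction_mat_eq)

lemma scheme_step_iff:
  assumes u: "u \<in> carrier_vec N" and w: "w \<in> carrier_vec N"
  shows "scheme_step N T M u w \<longleftrightarrow> step_mat N T M u *\<^sub>v w = (1 / timestep T M) \<cdot>\<^sub>v u"
proof -
  define t where "t = 1 / timestep T M"
  define R where "R = G_mat u * Dinv_mat N ^\<^sub>m 2"
  have C: "C_mat N \<in> carrier_mat N N" by (rule C_mat_carrier)
  have R: "R \<in> carrier_mat N N" by (simp add: R_def reaction_mat_eq[OF u])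
  have tw: "(t \<cdot>\<^sub>m 1\<^sub>m N) *\<^sub>v w = t \<cdot>\<^sub>v w"
    using w by (intro eq_vecI) auto
  have "step_mat N T M u *\<^sub>v w = t \<cdot>\<^sub>v w + C_mat N *\<^sub>v w + R *\<^sub>v w"
    unfolding step_mat_def t_def[symmetric] R_def[symmetric] using C R w
    by (simp add: add_mult_distrib_mat_vec[of _ N N] tw)
  moreover have "- C_mat N *\<^sub>v w = - (C_mat N *\<^sub>v w)"
    using C w by (intro eq_vecI) (auto simp: scalar_prod_def sum_negf)
  moreover have "t \<cdot>\<^sub>v (w - u) = - x - y \<longleftrightarrow> t \<cdot>\<^sub>v w + x + y = t \<cdot>\<^sub>v u"
    if "x \<in> carrier_vec N" "y \<in> carrier_vec N" for x y
    using that u w by (auto simp: vec_eq_iff algebra_simps)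
  ultimately show ?thesis
    unfolding scheme_step_def t_def[symmetric] R_def[symmetric] using C R w by simp
qed

text \<open>Row \<open>i\<close> belongs to the grid point \<open>Suc i\<close> times the mesh
  width, so the drift term also scales like the inverse square of the mesh width and merges with the
  entries of \<open>A_mat\<close>.\<close>

lemma C_mat_entry:
  assumes "i < N" "j < N"
  shows "C_mat N $$ (i, j) = (if i = j then 2 / (meshwidth N)\<^sup>2
      else if i = Suc j then - (1 - 1 / (2 * real (Suc i))) / (meshwidth N)\<^sup>2
      else if j = Suc i then - (1 + 1 / (2 * real (Suc i))) / (meshwidth N)\<^sup>2
      else 0)"
proof -
  define s where "s = real (Suc i)"
  have "0 < s" by (simp add: s_def)
  have "C_mat N $$ (i, j) =
      A_mat N $$ (i, j) - 1 / gridpt N (Suc i) * B_mat N $$ (i, j)"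
    using assms
    by (simp add: C_mat_def Dinv_mat_eq B_mat_def tridiag_def mat_diag_mult_left[of _ N N])
  moreover have "- 1 / m\<^sup>2 - 1 / (s * m) * (- 1 / (2 * m)) = - (1 - 1 / (2 * s)) / m\<^sup>2"
    "- 1 / m\<^sup>2 - 1 / (s * m) * (1 / (2 * m)) = - (1 + 1 / (2 * s)) / m\<^sup>2"
    if "0 < m" "0 < s" for m s :: real
    using that by (simp_all add: field_simps power2_eq_square)
  note this[OF meshwidth_pos[of N], of s]
  ultimately show ?thesis
    unfolding s_def[symmetric] using assms \<open>0 < s\<close>
    by (simp add: A_mat_def B_mat_def tridiag_def gridpt_def s_def[symmetric] del: of_nat_Suc)
qed

section \<open>Diagonal dominance of the step matrix\<close>

lemma sinc_nonneg:
  fixes y :: real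
  assumes "\<bar>y\<bar> \<le> pi / 2"
  shows "0 \<le> sin (2 * y) / (2 * y)"
proof -
  \<comment> \<open>The quotient is even in \<open>y\<close>, and sine is nonnegative on [0, pi]. At
    \<open>y = 0\<close> division by zero yields 0.\<close>
  have "0 \<le> sin \<bar>2 * y\<bar> / \<bar>2 * y\<bar>"
    using assms by (intro divide_nonneg_nonneg sin_ge_zero) auto
  then show ?thesis by (auto simp: abs_if split: if_splits)
qed

lemma step_mat_entry:
  assumes "u \<in> carrier_vec N" "i < N" "j < N"
  shows "step_mat N T M u $$ (i, j) = C_mat N $$ (i, j) + (if i = j then 1 / timestep T M +
    (if u $ j = 0 then 1 else sin (2 * u $ j) / (2 * u $ j)) / (gridpt N (Suc j))\<^sup>2 else 0)"
  using assms carrier_matD[OF C_mat_carrier[of N]]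
  by (simp add: step_mat_def reaction_mat_eq mat_diag_def)

text \<open>The drift contributions \<open>e\<close> and \<open>- e\<close> cancel in the row sum,
  which is therefore at most the diagonal entry of \<open>C_mat\<close>; the reaction term only
  increases the diagonal.\<close>

lemma step_mat_diag_dominant:
  assumes u: "u \<in> carrier_vec N" and bound: "linf_norm u \<le> pi / 2" and i: "i < N"
  shows "1 / timestep T M + (\<Sum>j\<in>{..<N} - {i}. \<bar>step_mat N T M u $$ (i, j)\<bar>)
    \<le> step_mat N T M u $$ (i, i)"
proof -
  define S where "S = step_mat N T M u"
  define h where "h = (meshwidth N)\<^sup>2"
  define e where "e = 1 / (2 * real (Suc i))"
  have h: "0 < h" using meshwidth_pos[of N] by (simp add: h_def)
  have e: "0 \<le> e" "e \<le> 1" by (simp_all add: e_def)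
  \<comment> \<open>For \<open>i = 0\<close> truncated subtraction makes \<open>i - 1\<close> equal
    to \<open>i\<close>, an index that is excluded here.\<close>
  have off: "\<bar>S $$ (i, j)\<bar> \<le>
      (if j = i - 1 then (1 - e) / h else 0) + (if j = Suc i then (1 + e) / h else 0)"
    if "j \<in> {..<N} - {i}" for j
  proof -
    have "S $$ (i, j) = (if i = Suc j then - (1 - e) / h
        else if j = Suc i then - (1 + e) / h else 0)"
      using that i u by (simp add: S_def step_mat_entry C_mat_entry h_def e_def del: of_nat_Suc)
    then show ?thesis using e h by (auto simp: abs_divide add.commute)
  qed
  have "(\<Sum>j\<in>{..<N} - {i}. \<bar>S $$ (i, j)\<bar>) \<le> (\<Sum>j\<in>{..<N} - {i}.
      (if j = i - 1 then (1 - e) / h else 0) + (if j = Suc i then (1 + e) / h else 0))"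
    by (rule sum_mono[OF off])
  \<comment> \<open>Only an inequality: the first and the last row lack a neighbour.\<close>
  also have "\<dots> \<le> (1 - e) / h + (1 + e) / h"
    unfolding sum.distrib using e h by (intro add_mono) (auto simp: sum.delta)
  also have "\<dots> = 2 / h" by (simp add: add_divide_distrib[symmetric])
  finally have sum: "(\<Sum>j\<in>{..<N} - {i}. \<bar>S $$ (i, j)\<bar>) \<le> 2 / h" .
  \<comment> \<open>The bound pi/2 enters here, to keep the reaction coefficient
    nonnegative.\<close>
  have "\<bar>u $ i\<bar> \<le> pi / 2" using linf_norm_ge[of i u] u i bound by simp
  then have "0 \<le> (if u $ i = 0 then 1 else sin (2 * u $ i) / (2 * u $ i)) / (gridpt N (Suc i))\<^sup>2"
    using sinc_nonneg by (intro divide_nonneg_nonneg) auto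
  then have "1 / timestep T M + 2 / h \<le> S $$ (i, i)"
    using i u by (simp add: S_def step_mat_entry C_mat_entry h_def)
  then show ?thesis using sum by (simp add: S_def)
qed

section \<open>Solvability and stability of the scheme\<close>

lemma scheme_step_ex1:
  assumes "0 < timestep T M" "u \<in> carrier_vec N" "linf_norm u \<le> pi / 2"
  shows "\<exists>!w. w \<in> carrier_vec N \<and> scheme_step N T M u w"
proof -
  have "\<exists>!w. w \<in> carrier_vec N \<and> step_mat N T M u *\<^sub>v w = (1 / timestep T M) \<cdot>\<^sub>v u"
    using assms by (intro diag_dominant_ex1_solution[where c = "1 / timestep T M"]
        step_mat_carrier step_mat_diag_dominant) auto
  then show ?thesis by (simp add: scheme_step_iff[OF assms(2)] cong: conj_cong)
qed

text \<open>The dominance excess equals the factor in front of \<open>u\<close> on the right-hand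
  side, so both cancel and the constant is exactly 1, whatever the step size.\<close>

lemma scheme_step_linf_norm_le:
  assumes t: "0 < timestep T M" and N: "0 < N"
    and u: "u \<in> carrier_vec N" "linf_norm u \<le> pi / 2"
    and w: "w \<in> carrier_vec N" "scheme_step N T M u w"
  shows "linf_norm w \<le> linf_norm u"
proof -
  have "1 / timestep T M * linf_norm w \<le> linf_norm (step_mat N T M u *\<^sub>v w)"
    using step_mat_carrier[OF u(1)] w(1) N step_mat_diag_dominant[OF u]
    by (rule diag_dominant_linf_norm_le)
  also have "\<dots> = 1 / timestep T M * linf_norm u"
    using w u N t by (simp add: scheme_step_iff linf_norm_smult)
  finally show ?thesis using t by (simp add: divide_le_cancel)
qed

text \<open>Since the norm never grows, each step hands the bound pi/2 on to the next, which needs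
  it for dominance.\<close>

lemma scheme_upto_linf_norm_le:
  assumes t: "0 < timestep T M" and N: "0 < N"
    and start: "linf_norm (start_vec N u0) \<le> pi / 2"
    and U: "scheme_upto N T M u0 n U" and "k \<le> n"
  shows "linf_norm (U k) \<le> linf_norm (start_vec N u0)"
  using \<open>k \<le> n\<close>
proof (induction k)
  case 0
  then show ?case using U by (simp add: scheme_upto_def)
next
  case (Suc k)
  then have IH: "linf_norm (U k) \<le> linf_norm (start_vec N u0)" by simp
  have "linf_norm (U (Suc k)) \<le> linf_norm (U k)"
    using U Suc.prems IH start
    by (intro scheme_step_linf_norm_le[OF t N]) (auto simp: scheme_upto_def)
  with IH show ?case by simp
qed

lemma scheme_upto_step_ex1:
  assumes "0 < timestep T M" "0 < N" "linf_norm (start_vec N u0) \<le> pi / 2"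
    and U: "scheme_upto N T M u0 n U"
  shows "\<exists>!w. w \<in> carrier_vec N \<and> scheme_step N T M (U n) w"
  using assms scheme_upto_linf_norm_le[OF assms order_refl]
  by (intro scheme_step_ex1) (auto simp: scheme_upto_def)

lemma scheme_upto_exists:
  assumes "0 < timestep T M" "0 < N" "linf_norm (start_vec N u0) \<le> pi / 2"
  shows "\<exists>U. scheme_upto N T M u0 n U"
proof (induction n)
  case 0
  show ?case
    by (rule exI[of _ "\<lambda>_. start_vec N u0"]) (simp add: scheme_upto_def start_vec_def)
next
  case (Suc n)
  then obtain U where U: "scheme_upto N T M u0 n U" by blast
  obtain w where "w \<in> carrier_vec N" "scheme_step N T M (U n) w"
    using scheme_upto_step_ex1[OF assms U] by blast
  \<comment> \<open>Changing \<open>U\<close> at \<open>Suc n\<close> leaves the first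
    \<open>n\<close> steps intact.\<close>
  then have "scheme_upto N T M u0 (Suc n) (U(Suc n := w))"
    using U by (auto simp: scheme_upto_def less_Suc_eq le_Suc_eq)
  then show ?case by blast
qed

theorem lemma3p3:
  fixes T :: real and N M :: nat and u0 :: "real \<Rightarrow> real"
  assumes "T > 0" and "N \<ge> 1" and "M \<ge> 1"
    and "u0 0 = 0" and "u0 1 = 0"
    and "linf_norm (start_vec N u0) \<le> pi / 2"
  shows "(\<forall>n<M. \<forall>U. scheme_upto N T M u0 n U \<longrightarrow>
            (\<exists>!w. w \<in> carrier_vec N \<and> scheme_step N T M (U n) w))
       \<and> (\<exists>U. scheme_upto N T M u0 M U)
       \<and> (\<forall>U. scheme_upto N T M u0 M U \<longrightarrow>
            (\<forall>n\<le>M. linf_norm (U n) \<le> linf_norm (start_vec N u0)))"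
proof -
  have t: "0 < timestep T M" using assms by (simp add: timestep_def)
  have N: "0 < N" using assms by simp
  show ?thesis
    by (intro conjI allI impI scheme_upto_step_ex1[OF t N assms(6)]
        scheme_upto_exists[OF t N assms(6)] scheme_upto_linf_norm_le[OF t N assms(6)])
qed

end
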